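(* Let $A\in\mathbb{R}^{d\times d}$ be symmetric, let $b\in\mathbb{R}^d$ be nonzero, let $g$ be the grade of $b$ with respect to $A$, and run MINRES on $(A,b)$ with $x_0=0$. Let $1\le k<g$ and suppose the NPC condition has not been detected through iteration $k$, i.e. $c_{i-1}\gamma_i^{(1)}<0$ for all $1\le i\le k$. Then $$x_k^Tb-x_k^TAx_k>0,$$ $$x_k^Tr_k>x_{k-1}^Tr_k\ge 0,$$ $$x_k^Tr_{k-1}>x_k^Tr_k>0,$$ and the equality $x_{k-1}^Tr_k=0$ in the second line holds only at $k=1$.
   Context: Notation: $\|\cdot\|$ is the Euclidean norm. The Krylov subspace is $\mathcal{K}_k(A,b)=\mathrm{Span}\{b,Ab,\dots,A^{k-1}b\}$. The grade of $b$ with respect to $A$ is the positive integer $g$ such that $\dim\mathcal{K}_k(A,b)=k$ for $k\le g$ and $=g$ for $k>g$. MINRES (exact arithmetic). Initialize $\beta_1=\|b\|$, $r_0=b$, $v_1=b/\beta_1$, $v_0=x_0=\mathbf{d}_0=\mathbf{d}_{-1}=0$, $c_0=-1$, $s_0=0$, $\phi_0=\tau_0=\beta_1$, $\delta_1^{(1)}=0$. For $k=1,2,\dots,g$: set $\alpha_k=v_k^TAv_k$, $p_k=Av_k-\beta_kv_{k-1}-\alpha_kv_k$, $\beta_{k+1}=\|p_k\|$; $\delta_k^{(2)}=c_{k-1}\delta_k^{(1)}+s_{k-1}\alpha_k$, $\gamma_k^{(1)}=s_{k-1}\delta_k^{(1)}-c_{k-1}\alpha_k$, $\epsilon_{k+1}=s_{k-1}\beta_{k+1}$,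 $\delta_{k+1}^{(1)}=-c_{k-1}\beta_{k+1}$, $\gamma_k^{(2)}=\sqrt{(\gamma_k^{(1)})^2+\beta_{k+1}^2}$. If $\gamma_k^{(2)}\ne0$: $c_k=\gamma_k^{(1)}/\gamma_k^{(2)}$, $s_k=\beta_{k+1}/\gamma_k^{(2)}$, $\tau_k=c_k\phi_{k-1}$, $\phi_k=s_k\phi_{k-1}$, $\mathbf{d}_k=(v_k-\delta_k^{(2)}\mathbf{d}_{k-1}-\epsilon_k\mathbf{d}_{k-2})/\gamma_k^{(2)}$, $x_k=x_{k-1}+\tau_k\mathbf{d}_k$, and, if $\beta_{k+1}\ne0$, $v_{k+1}=p_k/\beta_{k+1}$, $r_k=s_k^2r_{k-1}-\phi_kc_kv_{k+1}$, while if $\beta_{k+1}=0$, $r_k=0$ and the iteration stops. If $\gamma_k^{(2)}=0$: $c_k=0$, $s_k=1$, $\tau_k=0$, $\phi_k=\phi_{k-1}$, $r_k=r_{k-1}$, $x_k=x_{k-1}$ and the iteration stops. (The iterations are not stopped when the NPC condition below holds. The process stops after exactly $g$ iterations, $\beta_{k+1}>0$ for $k<g$, $\beta_{g+1}=0$; $x_k$ minimizes $\|b-Ax\|$ over $\mathcal{K}_k(A,b)$ and $r_k=b-Ax_k$.) NPC condition at iteration $k$: $c_{k-1}\gamma_k^{(1)}\ge0$. *)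

theory Defs
  imports "HOL-Analysis.Analysis"
begin

definition krylov :: "real^'n^'n \<Rightarrow> real^'n \<Rightarrow> nat \<Rightarrow> (real^'n) set" where
  "krylov A b k = span {(((*v) A) ^^ i) b | i. i < k}"

definition is_grade :: "real^'n^'n \<Rightarrow> real^'n \<Rightarrow> nat \<Rightarrow> bool" where
  "is_grade A b g \<longleftrightarrow> 0 < g \<and>
     (\<forall>k\<le>g. dim (krylov A b k) = k) \<and> (\<forall>k>g. dim (krylov A b k) = g)"

text \<open>
  The state after iteration \<open>k\<close> of MINRES (\<open>k = 0\<close>: initialization). The field indices relative
  to \<open>k\<close> are as follows. The fields
  \<open>mr_c\<close>, \<open>mr_s\<close>, \<open>mr_phi\<close>, \<open>mr_tau\<close>, \<open>mr_d\<close>, \<open>mr_x\<close>, \<open>mr_r\<close>, \<open>mr_gamma1\<close>, \<open>mr_gamma2\<close> carry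
  index \<open>k\<close>, whereas \<open>mr_beta\<close>, \<open>mr_v\<close>, \<open>mr_delta1\<close>, \<open>mr_eps\<close> carry index \<open>k + 1\<close>; finally
  \<open>mr_v_prev\<close> has index \<open>k\<close> and \<open>mr_d_prev\<close> has index \<open>k - 1\<close>.
  Here \<open>mr_delta1\<close>, \<open>mr_gamma1\<close>, \<open>mr_gamma2\<close> are the quantities with superscript (1), (1), (2).
\<close>

record 'v minres_state =
  mr_beta :: real
  mr_v :: 'v
  mr_v_prev :: 'v
  mr_delta1 :: real
  mr_eps :: real
  mr_gamma1 :: real
  mr_gamma2 :: real
  mr_c :: real
  mr_s :: real
  mr_phi :: real
  mr_tau :: real
  mr_d :: 'v
  mr_d_prev :: 'v
  mr_x :: 'v
  mr_r :: 'v
  mr_stopped :: bool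

text \<open>
  The first \<open>mr_eps\<close> only ever multiplies the zero vector \<open>mr_d_prev\<close>, and the initial
  \<open>mr_gamma1\<close>, \<open>mr_gamma2\<close> are overwritten before being read, so their values are immaterial.
\<close>

definition minres_init :: "real^'n \<Rightarrow> (real^'n) minres_state" where
  "minres_init b =
    \<lparr> mr_beta = norm b, mr_v = (1 / norm b) *\<^sub>R b, mr_v_prev = 0,
      mr_delta1 = 0, mr_eps = 0, mr_gamma1 = 0, mr_gamma2 = 0,
      mr_c = - 1, mr_s = 0, mr_phi = norm b, mr_tau = norm b,
      mr_d = 0, mr_d_prev = 0, mr_x = 0, mr_r = b, mr_stopped = False \<rparr>"

text \<open>
  Once the iteration has stopped, the state is frozen. Quantities that the stopping branches of the
  algorithm leave undefined keep their old values; they are never read again.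
\<close>

definition minres_step ::
    "real^'n^'n \<Rightarrow> (real^'n) minres_state \<Rightarrow> (real^'n) minres_state" where
  "minres_step A S =
    (if mr_stopped S then S else
     let \<beta> = mr_beta S; v = mr_v S; \<delta>1 = mr_delta1 S; c = mr_c S; s = mr_s S;
         \<alpha> = v \<bullet> (A *v v);
         p = A *v v - \<beta> *\<^sub>R mr_v_prev S - \<alpha> *\<^sub>R v;
         \<beta>' = norm p;
         \<delta>2 = c * \<delta>1 + s * \<alpha>;
         \<gamma>1 = s * \<delta>1 - c * \<alpha>;
         \<gamma>2 = sqrt (\<gamma>1\<^sup>2 + \<beta>'\<^sup>2);
         T = S \<lparr> mr_beta := \<beta>', mr_eps := s * \<beta>', mr_delta1 := - c * \<beta>',
                 mr_gamma1 := \<gamma>1, mr_gamma2 := \<gamma>2 \<rparr>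
     in if \<gamma>2 \<noteq> 0 then
          let c' = \<gamma>1 / \<gamma>2; s' = \<beta>' / \<gamma>2; \<tau>' = c' * mr_phi S; \<phi>' = s' * mr_phi S;
              d' = (1 / \<gamma>2) *\<^sub>R (v - \<delta>2 *\<^sub>R mr_d S - mr_eps S *\<^sub>R mr_d_prev S);
              U = T \<lparr> mr_c := c', mr_s := s', mr_tau := \<tau>', mr_phi := \<phi>',
                      mr_d := d', mr_d_prev := mr_d S, mr_x := mr_x S + \<tau>' *\<^sub>R d' \<rparr>
          in if \<beta>' \<noteq> 0 then
               let v' = (1 / \<beta>') *\<^sub>R p
               in U \<lparr> mr_v := v', mr_v_prev := v,
                      mr_r := s'\<^sup>2 *\<^sub>R mr_r S - (\<phi>' * c') *\<^sub>R v' \<rparr>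
             else U \<lparr> mr_r := 0, mr_stopped := True \<rparr>
        else T \<lparr> mr_c := 0, mr_s := 1, mr_tau := 0, mr_stopped := True \<rparr>)"

definition minres :: "real^'n^'n \<Rightarrow> real^'n \<Rightarrow> nat \<Rightarrow> (real^'n) minres_state" where
  "minres A b k = (minres_step A ^^ k) (minres_init b)"

abbreviation "minres_x A b k \<equiv> mr_x (minres A b k)"
abbreviation "minres_r A b k \<equiv> mr_r (minres A b k)"
abbreviation "minres_c A b k \<equiv> mr_c (minres A b k)"
abbreviation "minres_gamma1 A b k \<equiv> mr_gamma1 (minres A b k)"

end

theory Submission imports Defs begin

text \<open>
  Write \<open>K\<^sub>k\<close> for the Krylov subspace of dimension \<open>k\<close> and \<open>q\<^sub>k = r\<^sub>k / \<phi>\<^sub>k\<close> for the normalized residual.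
  Everything follows from two facts.

  First, as long as the condition for nonpositive curvature has not been met, \<open>A\<close> is positive definite
  on \<open>K\<^sub>k\<close>. The residuals of MINRES are \<open>A\<close>-conjugate, because \<open>r\<^sub>j\<close> is orthogonal to \<open>A K\<^sub>j\<close>, which
  contains \<open>A r\<^sub>i\<close> for \<open>i < j\<close>; and the scalar that the algorithm monitors is their curvature:
  \<open>q\<^sub>j \<bullet> A q\<^sub>j = - c\<^sub>j \<gamma>\<^sub>j\<^sub>+\<^sub>1\<close> (lemma \<open>residual_curvature\<close>), where \<open>\<gamma>\<close> is the quantity with superscript
  (1). Since \<open>c\<^sub>j \<noteq> 0\<close>, the vector \<open>r\<^sub>j\<close> completes \<open>K\<^sub>j\<close> to \<open>K\<^sub>j\<^sub>+\<^sub>1\<close>, so positivity extends from one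
  Krylov subspace to the next (\<open>positive_definite_extend\<close>).

  Second, each step is a plane rotation: the orthonormal pair \<open>(A d\<^sub>k, q\<^sub>k)\<close> is obtained from
  \<open>(q\<^sub>k\<^sub>-\<^sub>1, v\<^sub>k\<^sub>+\<^sub>1)\<close> by
  \<open>A d\<^sub>k = c\<^sub>k q\<^sub>k\<^sub>-\<^sub>1 + s\<^sub>k v\<^sub>k\<^sub>+\<^sub>1\<close> and \<open>q\<^sub>k = s\<^sub>k q\<^sub>k\<^sub>-\<^sub>1 - c\<^sub>k v\<^sub>k\<^sub>+\<^sub>1\<close> (\<open>A_d'\<close>, \<open>residual_direction_S'\<close>).
  As \<open>v\<^sub>k\<^sub>+\<^sub>1\<close> is orthogonal to \<open>K\<^sub>k\<close>, pairing a vector of \<open>K\<^sub>k\<close> with \<open>r\<^sub>k\<close> is \<open>s\<^sub>k\<^sup>2\<close> times pairing it with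
  \<open>r\<^sub>k\<^sub>-\<^sub>1\<close>, and the first identity paired with \<open>d\<^sub>k\<close> gives
  \<open>(x\<^sub>k - x\<^sub>k\<^sub>-\<^sub>1) \<bullet> r\<^sub>k = \<phi>\<^sub>k\<^sup>2 (d\<^sub>k \<bullet> A d\<^sub>k)\<close> (\<open>increment_inner_residual\<close>), which is positive by the first
  fact. Hence \<open>x\<^sub>k \<bullet> r\<^sub>k > x\<^sub>k\<^sub>-\<^sub>1 \<bullet> r\<^sub>k = s\<^sub>k\<^sup>2 (x\<^sub>k\<^sub>-\<^sub>1 \<bullet> r\<^sub>k\<^sub>-\<^sub>1)\<close>. By induction from \<open>x\<^sub>0 = 0\<close> the right-hand
  side is nonnegative and vanishes only for \<open>k = 1\<close>. Finally
  \<open>x\<^sub>k \<bullet> r\<^sub>k = s\<^sub>k\<^sup>2 (x\<^sub>k \<bullet> r\<^sub>k\<^sub>-\<^sub>1)\<close> with \<open>0 < s\<^sub>k\<^sup>2 < 1\<close> gives the strict decrease in the residual, and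
  \<open>x\<^sub>k \<bullet> r\<^sub>k\<close> is the first quantity of the theorem because \<open>r\<^sub>k = b - A x\<^sub>k\<close>.

  Before the grade is reached no breakdown occurs: a vanishing Lanczos vector would make \<open>K\<^sub>k\<close>
  invariant under \<open>A\<close> (\<open>p_nonzero\<close>).
\<close>

section \<open>Krylov subspaces\<close>

lemma symmetric_matrix_inner:
  fixes A :: "real^'n^'n"
  assumes "transpose A = A"
  shows "x \<bullet> (A *v y) = (A *v x) \<bullet> y"
  by (metis assms dot_lmul_matrix transpose_matrix_vector)

lemma subspace_krylov: "subspace (krylov A b k)"
  by (simp add: krylov_def)

lemma krylov_0: "krylov A b 0 = {0}"
  by (simp add: krylov_def)

lemma krylov_mono: "j \<le> k \<Longrightarrow> krylov A b j \<subseteq> krylov A b k"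
  unfolding krylov_def by (rule span_mono) auto

lemma power_in_krylov: "i < k \<Longrightarrow> (((*v) A) ^^ i) b \<in> krylov A b k"
  unfolding krylov_def by (rule span_base) auto

lemma matrix_image_krylov:
  assumes "y \<in> krylov A b k"
  shows "A *v y \<in> krylov A b (Suc k)"
proof -
  have "(*v) A ` {(((*v) A) ^^ i) b | i. i < k} \<subseteq> {(((*v) A) ^^ i) b | i. i < Suc k}"
  proof (clarify)
    fix i assume "i < k"
    then show "\<exists>j. A *v (((*v) A) ^^ i) b = (((*v) A) ^^ j) b \<and> j < Suc k"
      by (intro exI[of _ "Suc i"]) simp
  qed
  then have "(*v) A ` krylov A b k \<subseteq> krylov A b (Suc k)"
    unfolding krylov_def
    by (simp only: span_mono flip: linear_span_image[OF matrix_vector_mul_linear])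
  then show ?thesis using assms by blast
qed

lemma krylov_invariant_imp_stagnates:
  assumes "0 < k" and "\<And>y. y \<in> krylov A b k \<Longrightarrow> A *v y \<in> krylov A b k"
  shows "krylov A b (Suc k) = krylov A b k"
proof
  have "(((*v) A) ^^ i) b \<in> krylov A b k" for i
  proof (induction i)
    case 0
    show ?case using power_in_krylov[of 0 k A b] assms(1) by simp
  next
    case (Suc i)
    then show ?case using assms(2) by simp
  qed
  then show "krylov A b (Suc k) \<subseteq> krylov A b k"
    unfolding krylov_def[of A b "Suc k"] by (intro span_minimal subspace_krylov) auto
qed (simp add: krylov_mono)

section \<open>The state of a regular MINRES iteration\<close>

definition residual_direction :: "(real^'n) minres_state \<Rightarrow> real^'n" where
  "residual_direction S = (1 / mr_phi S) *\<^sub>R mr_r S"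

text \<open>
  The invariant of the iteration. The last two assumptions are the rotation
  \<open>A d = c q\<^sub>- + s v\<close>, \<open>q = s q\<^sub>- - c v\<close> of the preceding step solved for \<open>v\<close> and for the previous
  residual direction \<open>q\<^sub>- = c (A d) + s q\<close>, so that they speak of the current state only; the second
  of them is the identity for \<open>v\<close> one step earlier, scaled by \<open>\<beta>\<close>, with \<open>\<delta>1 = - c\<^sub>- \<beta>\<close> and
  \<open>\<epsilon> = s\<^sub>- \<beta>\<close>. Assumption \<open>lanczos\<close> replaces the orthonormality of all earlier Lanczos vectors.
\<close>

locale minres_regular =
  fixes A :: "real^'n^'n" and b :: "real^'n" and g k :: nat and S :: "(real^'n) minres_state"
  assumes sym: "transpose A = A"
    and grade: "is_grade A b g"
    and k_less: "k < g"
    and running: "\<not> mr_stopped S"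
    and v_unit: "norm (mr_v S) = 1"
    and v_in: "mr_v S \<in> krylov A b (Suc k)"
    and v_orth: "y \<in> krylov A b k \<Longrightarrow> mr_v S \<bullet> y = 0"
    and v_prev_in: "mr_v_prev S \<in> krylov A b k"
    and lanczos: "y \<in> krylov A b k \<Longrightarrow> mr_v S \<bullet> (A *v y) = mr_beta S * (mr_v_prev S \<bullet> y)"
    and phi_pos: "0 < mr_phi S"
    and x_in: "mr_x S \<in> krylov A b k"
    and d_in: "mr_d S \<in> krylov A b k"
    and d_prev_in: "mr_d_prev S \<in> krylov A b k"
    and residual: "mr_r S = b - A *v mr_x S"
    and q_unit: "norm (residual_direction S) = 1"
    and q_leading: "residual_direction S + mr_c S *\<^sub>R mr_v S \<in> krylov A b k"
    and q_orth: "y \<in> krylov A b k \<Longrightarrow> residual_direction S \<bullet> (A *v y) = 0"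
    and v_rotated: "mr_v S = mr_s S *\<^sub>R (A *v mr_d S) - mr_c S *\<^sub>R residual_direction S"
    and v_prev_rotated: "mr_beta S *\<^sub>R mr_v_prev S =
      mr_delta1 S *\<^sub>R (mr_c S *\<^sub>R (A *v mr_d S) + mr_s S *\<^sub>R residual_direction S)
      + mr_eps S *\<^sub>R (A *v mr_d_prev S)"
begin

abbreviation "K \<equiv> krylov A b k"
abbreviation "K' \<equiv> krylov A b (Suc k)"
abbreviation "v \<equiv> mr_v S"
abbreviation "q \<equiv> residual_direction S"

definition "\<alpha> = v \<bullet> (A *v v)"
definition "p = A *v v - mr_beta S *\<^sub>R mr_v_prev S - \<alpha> *\<^sub>R v"
definition "\<delta>2 = mr_c S * mr_delta1 S + mr_s S * \<alpha>"
definition "\<gamma>1 = mr_s S * mr_delta1 S - mr_c S * \<alpha>"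
definition "\<gamma>2 = sqrt (\<gamma>1\<^sup>2 + (norm p)\<^sup>2)"
definition "c' = \<gamma>1 / \<gamma>2"
definition "s' = norm p / \<gamma>2"
definition "v' = (1 / norm p) *\<^sub>R p"
definition "d' = (1 / \<gamma>2) *\<^sub>R (v - \<delta>2 *\<^sub>R mr_d S - mr_eps S *\<^sub>R mr_d_prev S)"
definition "S' = minres_step A S"

lemmas krylov_closed [intro] =
  subspace_add[OF subspace_krylov] subspace_diff[OF subspace_krylov]
  subspace_scale[OF subspace_krylov] subspace_0[OF subspace_krylov]

lemma K_subset: "y \<in> K \<Longrightarrow> y \<in> K'"
  using krylov_mono[of k "Suc k"] by auto

lemma v_v: "v \<bullet> v = 1"
  using v_unit by (simp add: dot_square_norm)

lemma q_q: "q \<bullet> q = 1"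
  using q_unit by (simp add: dot_square_norm)

lemma residual_eq_phi_q: "mr_r S = mr_phi S *\<^sub>R q"
  using phi_pos by (simp add: residual_direction_def)

lemma q_in: "q \<in> K'"
proof -
  have "q = (q + mr_c S *\<^sub>R v) - mr_c S *\<^sub>R v" by simp
  then show ?thesis using K_subset[OF q_leading] v_in by (metis krylov_closed(2,3))
qed

text \<open>
  The vector \<open>v\<close> lies in \<open>K'\<close> but not in \<open>K\<close>, and the grade says that the dimensions of the two
  differ by exactly one.
\<close>

lemma krylov_Suc_decompose:
  assumes "y \<in> K'"
  obtains z a where "z \<in> K" "y = z + a *\<^sub>R v"
proof -
  have "v \<notin> K" using v_orth v_v by force
  then have "dim (insert v K) = Suc k"
    using grade k_less by (simp add: dim_insert subspace_krylov span_eq_iff[THEN iffD2] is_grade_def)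
  moreover have "span (insert v K) \<subseteq> K'"
    using v_in K_subset by (intro span_minimal subspace_krylov) auto
  moreover have "dim K' = Suc k" using grade k_less by (simp add: is_grade_def)
  ultimately have "span (insert v K) = K'"
    by (intro subspace_dim_equal) (auto simp: subspace_krylov)
  then obtain a where "y - a *\<^sub>R v \<in> K"
    using assms by (auto simp: span_insert span_eq_iff[THEN iffD2, OF subspace_krylov])
  then show ?thesis by (intro that[of "y - a *\<^sub>R v" a]) auto
qed

lemma A_v: "A *v v = p + mr_beta S *\<^sub>R mr_v_prev S + \<alpha> *\<^sub>R v"
  by (simp add: p_def)

text \<open>
  Against \<open>K\<close>, symmetry moves \<open>A\<close> to the other side, where \<open>lanczos\<close> cancels the term of the
  previous vector; against \<open>v\<close>, the choice of \<open>\<alpha>\<close> does it. This is why a three-term recurrence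
  orthogonalizes against the whole subspace.
\<close>

lemma p_orth:
  assumes "y \<in> K'"
  shows "p \<bullet> y = 0"
proof -
  obtain z a where z: "z \<in> K" "y = z + a *\<^sub>R v"
    using krylov_Suc_decompose[OF assms] .
  have "p \<bullet> z = 0"
    using lanczos[OF z(1)] v_orth[OF z(1)] symmetric_matrix_inner[OF sym, of v z]
    by (simp add: p_def inner_diff_left)
  moreover have "p \<bullet> v = 0"
    using v_orth[OF v_prev_in] v_v
    by (subst inner_commute) (simp add: p_def inner_diff_right \<alpha>_def)
  ultimately show ?thesis by (simp add: z inner_add_right)
qed

lemma p_nonzero:
  assumes "Suc k < g"
  shows "p \<noteq> 0"
proof
  assume p0: "p = 0"
  have Av: "A *v v \<in> K'"
    unfolding A_v using p0 K_subset[OF v_prev_in] v_in by auto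
  have "A *v y \<in> K'" if "y \<in> K'" for y
  proof -
    obtain z a where z: "z \<in> K" "y = z + a *\<^sub>R v"
      using krylov_Suc_decompose[OF \<open>y \<in> K'\<close>] .
    then have "A *v y = A *v z + a *\<^sub>R (A *v v)"
      by (simp add: matrix_vector_right_distrib matrix_vector_mult_scaleR)
    then show ?thesis using matrix_image_krylov[OF z(1)] Av by auto
  qed
  then have "krylov A b (Suc (Suc k)) = K'"
    by (intro krylov_invariant_imp_stagnates) auto
  moreover have "dim (krylov A b (Suc (Suc k))) = Suc (Suc k)" "dim K' = Suc k"
    using grade assms by (auto simp: is_grade_def)
  ultimately show False by simp
qed

lemma \<gamma>2_d': "\<gamma>2 \<noteq> 0 \<Longrightarrow> \<gamma>2 *\<^sub>R d' = v - \<delta>2 *\<^sub>R mr_d S - mr_eps S *\<^sub>R mr_d_prev S"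
  by (simp add: d'_def)

text \<open>
  The coefficients \<open>\<delta>2\<close> and \<open>\<gamma>1\<close> are the rotation of \<open>(\<delta>1, \<alpha>)\<close> by \<open>(c, s)\<close>, and the invariant
  expresses \<open>\<beta> v_prev\<close> and \<open>\<alpha> v\<close> in the correspondingly rotated vectors \<open>A d\<close> and \<open>q\<close>. Subtracting
  the two previous directions therefore cancels everything except \<open>p\<close> and a multiple of \<open>q\<close>.
\<close>

lemma A_new_direction:
  "A *v (v - \<delta>2 *\<^sub>R mr_d S - mr_eps S *\<^sub>R mr_d_prev S) = p + \<gamma>1 *\<^sub>R q"
proof -
  define D where "D = A *v mr_d S"
  have "A *v (v - \<delta>2 *\<^sub>R mr_d S - mr_eps S *\<^sub>R mr_d_prev S)
      = p + mr_beta S *\<^sub>R mr_v_prev S + \<alpha> *\<^sub>R v - \<delta>2 *\<^sub>R D - mr_eps S *\<^sub>R (A *v mr_d_prev S)"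
    by (simp add: matrix_vector_mult_diff_distrib matrix_vector_mult_scaleR A_v D_def)
  also have "\<dots> = p + mr_delta1 S *\<^sub>R (mr_c S *\<^sub>R D + mr_s S *\<^sub>R q)
      + \<alpha> *\<^sub>R (mr_s S *\<^sub>R D - mr_c S *\<^sub>R q) - \<delta>2 *\<^sub>R D"
    unfolding v_prev_rotated D_def[symmetric] using v_rotated D_def by simp
  also have "\<dots> = p + \<gamma>1 *\<^sub>R q"
    by (simp add: \<delta>2_def \<gamma>1_def algebra_simps)
  finally show ?thesis .
qed

lemma q_A_v: "q \<bullet> (A *v v) = \<gamma>1"
proof -
  have "q \<bullet> (A *v (v - \<delta>2 *\<^sub>R mr_d S - mr_eps S *\<^sub>R mr_d_prev S)) = q \<bullet> (A *v v)"
    using q_orth[OF d_in] q_orth[OF d_prev_in]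
    by (simp add: matrix_vector_mult_diff_distrib matrix_vector_mult_scaleR inner_diff_right)
  moreover have "q \<bullet> (p + \<gamma>1 *\<^sub>R q) = \<gamma>1"
    using p_orth[OF q_in] q_q by (simp add: inner_add_right inner_commute)
  ultimately show ?thesis by (simp add: A_new_direction)
qed

text \<open>
  Modulo \<open>K\<close> the vector \<open>q\<close> is \<open>- c v\<close>, and \<open>A K\<close> is orthogonal to \<open>q\<close>. Hence the monitored scalar
  \<open>c \<gamma>1\<close> is negative exactly when the residual is a direction of positive curvature.
\<close>

lemma residual_curvature: "q \<bullet> (A *v q) = - mr_c S * \<gamma>1"
proof -
  have "q \<bullet> (A *v (q + mr_c S *\<^sub>R v)) = 0" by (rule q_orth[OF q_leading])
  then show ?thesis
    by (simp add: matrix_vector_right_distrib matrix_vector_mult_scaleR inner_add_right q_A_v)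
qed

text \<open>
  For \<open>c \<noteq> 0\<close> the space \<open>K'\<close> is spanned by \<open>K\<close> and \<open>q\<close>. These are \<open>A\<close>-conjugate, so the quadratic
  form splits into its values on \<open>K\<close> and on the line of \<open>q\<close>.
\<close>

lemma positive_definite_extend:
  assumes pos: "\<And>y. y \<in> K \<Longrightarrow> y \<noteq> 0 \<Longrightarrow> 0 < y \<bullet> (A *v y)"
    and npc: "mr_c S * \<gamma>1 < 0"
    and y: "y \<in> K'" "y \<noteq> 0"
  shows "0 < y \<bullet> (A *v y)"
proof -
  have c: "mr_c S \<noteq> 0" using npc by auto
  obtain z a where z: "z \<in> K" "y = z + a *\<^sub>R v"
    using krylov_Suc_decompose[OF y(1)] .
  \<comment> \<open>The coefficient \<open>t\<close> is chosen so that \<open>t q\<close> and \<open>y\<close> have the same component along \<open>v\<close>.\<close>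
  define t where "t = - a / mr_c S"
  define w where "w = z - t *\<^sub>R (q + mr_c S *\<^sub>R v)"
  have w: "w \<in> K" unfolding w_def using z(1) q_leading by auto
  have y_eq: "y = w + t *\<^sub>R q"
    using c by (simp add: w_def t_def z scaleR_add_right)
  have "w \<bullet> (A *v q) = 0"
    using q_orth[OF w] symmetric_matrix_inner[OF sym, of w q] by (simp add: inner_commute)
  then have "y \<bullet> (A *v y) = w \<bullet> (A *v w) + t\<^sup>2 * (q \<bullet> (A *v q))"
    using q_orth[OF w]
    by (simp add: y_eq matrix_vector_right_distrib matrix_vector_mult_scaleR inner_add_left
        inner_add_right power2_eq_square)
  moreover have "0 < q \<bullet> (A *v q)" using npc by (simp add: residual_curvature)
  moreover have "w \<noteq> 0 \<or> t \<noteq> 0" using y(2) y_eq by auto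
  moreover have "0 \<le> w \<bullet> (A *v w)" using pos[OF w] by (cases "w = 0") auto
  ultimately show ?thesis
    using pos[OF w] by (cases "t = 0") (auto intro: add_nonneg_pos)
qed

context
  assumes more: "Suc k < g"
begin

lemma norm_p: "0 < norm p"
  using p_nonzero[OF more] by simp

lemma \<gamma>2_pos: "0 < \<gamma>2"
  unfolding \<gamma>2_def using norm_p by (intro real_sqrt_gt_zero add_nonneg_pos) auto

lemma \<gamma>2_square: "\<gamma>2\<^sup>2 = \<gamma>1\<^sup>2 + (norm p)\<^sup>2"
  by (simp add: \<gamma>2_def)

lemma rotation': "c'\<^sup>2 + s'\<^sup>2 = 1"
  unfolding c'_def s'_def power_divide add_divide_distrib[symmetric] \<gamma>2_square[symmetric]
  using \<gamma>2_pos by simp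

lemma s'_pos: "0 < s'"
  using norm_p \<gamma>2_pos by (simp add: s'_def)

lemma p_eq: "p = norm p *\<^sub>R v'"
  using norm_p by (simp add: v'_def)

lemma v'_orth: "y \<in> K' \<Longrightarrow> v' \<bullet> y = 0"
  by (simp add: v'_def p_orth)

lemma v'_v': "v' \<bullet> v' = 1"
  using norm_p by (simp add: v'_def dot_square_norm power2_eq_square)

lemma A_d': "A *v d' = c' *\<^sub>R q + s' *\<^sub>R v'"
proof -
  have "A *v d' = (1 / \<gamma>2) *\<^sub>R (p + \<gamma>1 *\<^sub>R q)"
    unfolding d'_def matrix_vector_mult_scaleR A_new_direction ..
  also have "\<dots> = c' *\<^sub>R q + s' *\<^sub>R v'"
    using norm_p by (simp add: c'_def s'_def v'_def scaleR_add_right)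
  finally show ?thesis .
qed

lemma d'_in: "d' \<in> K'"
  unfolding d'_def using v_in K_subset[OF d_in] K_subset[OF d_prev_in] by auto

lemma d'_nonzero: "d' \<noteq> 0"
proof
  assume "d' = 0"
  then have "v = \<delta>2 *\<^sub>R mr_d S + mr_eps S *\<^sub>R mr_d_prev S"
    using \<gamma>2_d' \<gamma>2_pos by (simp add: algebra_simps)
  then have "v \<in> K" using d_in d_prev_in by (metis krylov_closed(1,3))
  then show False using v_orth v_v by force
qed

lemma S'_eq:
  "S' = S \<lparr> mr_beta := norm p, mr_eps := mr_s S * norm p,
      mr_delta1 := - mr_c S * norm p, mr_gamma1 := \<gamma>1, mr_gamma2 := \<gamma>2,
      mr_c := c', mr_s := s', mr_tau := c' * mr_phi S, mr_phi := s' * mr_phi S,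
      mr_d := d', mr_d_prev := mr_d S, mr_x := mr_x S + (c' * mr_phi S) *\<^sub>R d',
      mr_v := v', mr_v_prev := v,
      mr_r := s'\<^sup>2 *\<^sub>R mr_r S - (s' * mr_phi S * c') *\<^sub>R v' \<rparr>"
proof -
  have eqs: "A *v v - mr_beta S *\<^sub>R mr_v_prev S - (v \<bullet> (A *v v)) *\<^sub>R v = p"
    "mr_s S * mr_delta1 S - mr_c S * (v \<bullet> (A *v v)) = \<gamma>1"
    "mr_c S * mr_delta1 S + mr_s S * (v \<bullet> (A *v v)) = \<delta>2"
    "sqrt (\<gamma>1\<^sup>2 + (norm p)\<^sup>2) = \<gamma>2"
    by (simp_all add: p_def \<alpha>_def \<gamma>1_def \<delta>2_def \<gamma>2_def)
  have nz: "\<gamma>2 \<noteq> 0" "norm p \<noteq> 0" using \<gamma>2_pos norm_p by auto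
  show ?thesis
    unfolding S'_def minres_step_def Let_def eqs
    using nz running by (simp add: c'_def s'_def v'_def d'_def)
qed

lemma S'_fields:
  "mr_beta S' = norm p" "mr_v S' = v'" "mr_v_prev S' = v" "mr_delta1 S' = - mr_c S * norm p"
  "mr_eps S' = mr_s S * norm p" "mr_gamma1 S' = \<gamma>1" "mr_c S' = c'" "mr_s S' = s'"
  "mr_phi S' = s' * mr_phi S" "mr_d S' = d'" "mr_d_prev S' = mr_d S"
  "mr_x S' = mr_x S + (c' * mr_phi S) *\<^sub>R d'"
  "mr_r S' = s'\<^sup>2 *\<^sub>R mr_r S - (s' * mr_phi S * c') *\<^sub>R v'"
  "\<not> mr_stopped S'"
  using running by (simp_all add: S'_eq)

lemma residual_direction_S': "residual_direction S' = s' *\<^sub>R q - c' *\<^sub>R v'"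
  using s'_pos phi_pos
  by (simp add: residual_direction_def[of S'] S'_fields residual_eq_phi_q scaleR_diff_right
      power2_eq_square)

lemma q_v': "q \<bullet> v' = 0" "v' \<bullet> q = 0"
  using v'_orth[OF q_in] by (simp_all add: inner_commute)

text \<open>
  The space \<open>K'\<close> is spanned by \<open>K\<close> and the new direction \<open>d'\<close>. On \<open>A K\<close> both parts of the new residual
  direction vanish, and \<open>A d'\<close> is its partner in a rotated orthonormal pair. This is the optimality
  condition of the least-squares problem that MINRES solves over \<open>K'\<close>.
\<close>

lemma residual_direction_S'_orth:
  assumes "y \<in> K'"
  shows "residual_direction S' \<bullet> (A *v y) = 0"
proof -
  obtain z a where z: "z \<in> K" "y = z + a *\<^sub>R v"
    using krylov_Suc_decompose[OF assms] .
  define w where "w = z + a *\<^sub>R (\<delta>2 *\<^sub>R mr_d S + mr_eps S *\<^sub>R mr_d_prev S)"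
  have w: "w \<in> K" unfolding w_def using z(1) d_in d_prev_in by auto
  have "v = \<delta>2 *\<^sub>R mr_d S + mr_eps S *\<^sub>R mr_d_prev S + \<gamma>2 *\<^sub>R d'"
    using \<gamma>2_d' \<gamma>2_pos by simp
  then have "a *\<^sub>R v = a *\<^sub>R (\<delta>2 *\<^sub>R mr_d S + mr_eps S *\<^sub>R mr_d_prev S) + a *\<^sub>R \<gamma>2 *\<^sub>R d'"
    by (simp only: scaleR_add_right)
  then have y_eq: "y = w + (a * \<gamma>2) *\<^sub>R d'"
    by (simp add: w_def z)
  have "residual_direction S' \<bullet> (A *v w) = 0"
    using q_orth[OF w] v'_orth[OF matrix_image_krylov[OF w]]
    by (simp add: residual_direction_S' inner_diff_left)
  moreover have "residual_direction S' \<bullet> (A *v d') = 0"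
    by (simp add: residual_direction_S' A_d' inner_diff_left inner_add_right q_q v'_v' q_v')
  ultimately show ?thesis
    by (simp add: y_eq matrix_vector_right_distrib matrix_vector_mult_scaleR inner_add_right)
qed

lemma step_regular: "minres_regular A b g (Suc k) S'"
proof
  show "transpose A = A" "is_grade A b g" "Suc k < g" by (fact sym grade more)+
  show "\<not> mr_stopped S'" by (simp add: S'_fields)
  show "norm (mr_v S') = 1" by (simp add: S'_fields norm_eq_1 v'_v')
  show "mr_v S' \<in> krylov A b (Suc (Suc k))"
  proof -
    have "p \<in> krylov A b (Suc (Suc k))"
      unfolding p_def
      using matrix_image_krylov[OF v_in] v_in v_prev_in
        krylov_mono[of "Suc k" "Suc (Suc k)" A b] krylov_mono[of k "Suc (Suc k)" A b]
      by (intro krylov_closed(2,3)) auto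
    then show ?thesis by (auto simp: S'_fields v'_def)
  qed
  show "mr_v S' \<bullet> y = 0" if "y \<in> K'" for y using v'_orth[OF that] by (simp add: S'_fields)
  show "mr_v_prev S' \<in> K'" by (simp add: S'_fields v_in)
  show "mr_v S' \<bullet> (A *v y) = mr_beta S' * (mr_v_prev S' \<bullet> y)" if "y \<in> K'" for y
  proof -
    obtain z a where z: "z \<in> K" "y = z + a *\<^sub>R v"
      using krylov_Suc_decompose[OF \<open>y \<in> K'\<close>] .
    have "v' \<bullet> (A *v z) = 0" by (rule v'_orth[OF matrix_image_krylov[OF z(1)]])
    moreover have "v' \<bullet> (A *v v) = norm p"
      using v'_orth[OF v_in] v'_orth[OF K_subset[OF v_prev_in]] v'_v'
      by (subst A_v, subst p_eq) (simp add: inner_add_right)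
    ultimately show ?thesis
      using v_orth[OF z(1)] v_v
      by (simp add: S'_fields z matrix_vector_right_distrib matrix_vector_mult_scaleR
          inner_add_right)
  qed
  show "0 < mr_phi S'" using s'_pos phi_pos by (simp add: S'_fields)
  show "mr_x S' \<in> K'" using K_subset[OF x_in] d'_in by (auto simp: S'_fields)
  show "mr_d S' \<in> K'" by (simp add: S'_fields d'_in)
  show "mr_d_prev S' \<in> K'" by (simp add: S'_fields K_subset d_in)
  show "mr_r S' = b - A *v mr_x S'"
  proof -
    have "b - A *v mr_x S' = mr_r S - (c' * mr_phi S) *\<^sub>R (c' *\<^sub>R q + s' *\<^sub>R v')"
      by (simp add: S'_fields residual matrix_vector_right_distrib matrix_vector_mult_scaleR A_d')
    also have "\<dots> = (1 - c'\<^sup>2) *\<^sub>R mr_r S - (s' * mr_phi S * c') *\<^sub>R v'"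
      by (simp add: residual_eq_phi_q algebra_simps power2_eq_square)
    also have "1 - c'\<^sup>2 = s'\<^sup>2" using rotation' by simp
    finally show ?thesis by (simp add: S'_fields)
  qed
  show "norm (residual_direction S') = 1"
    using rotation'
    by (simp add: norm_eq_1 residual_direction_S' inner_diff_left inner_diff_right q_q v'_v' q_v'
        power2_eq_square add.commute)
  show "residual_direction S' + mr_c S' *\<^sub>R mr_v S' \<in> K'"
    using q_in by (auto simp: residual_direction_S' S'_fields)
  show "residual_direction S' \<bullet> (A *v y) = 0" if "y \<in> K'" for y
    by (rule residual_direction_S'_orth[OF that])
  have inverse_rotation: "s' *\<^sub>R (A *v d') - c' *\<^sub>R residual_direction S' = v'"
    "c' *\<^sub>R (A *v d') + s' *\<^sub>R residual_direction S' = q"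
  proof -
    have "s' *\<^sub>R (A *v d') - c' *\<^sub>R residual_direction S' = (c'\<^sup>2 + s'\<^sup>2) *\<^sub>R v'"
      "c' *\<^sub>R (A *v d') + s' *\<^sub>R residual_direction S' = (c'\<^sup>2 + s'\<^sup>2) *\<^sub>R q"
      by (simp_all add: A_d' residual_direction_S' algebra_simps power2_eq_square)
    then show "s' *\<^sub>R (A *v d') - c' *\<^sub>R residual_direction S' = v'"
      "c' *\<^sub>R (A *v d') + s' *\<^sub>R residual_direction S' = q"
      by (simp_all add: rotation')
  qed
  then show "mr_v S' = mr_s S' *\<^sub>R (A *v mr_d S') - mr_c S' *\<^sub>R residual_direction S'"
    by (simp add: S'_fields)
  show "mr_beta S' *\<^sub>R mr_v_prev S' =
      mr_delta1 S' *\<^sub>R (mr_c S' *\<^sub>R (A *v mr_d S') + mr_s S' *\<^sub>R residual_direction S')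
      + mr_eps S' *\<^sub>R (A *v mr_d_prev S')"
  proof -
    have "norm p *\<^sub>R v = (- mr_c S * norm p) *\<^sub>R q + (mr_s S * norm p) *\<^sub>R (A *v mr_d S)"
      by (subst v_rotated) (simp add: algebra_simps)
    then show ?thesis unfolding S'_fields inverse_rotation .
  qed
qed

text \<open>
  The two residuals differ, up to the factor \<open>s'\<^sup>2\<close>, by a multiple of the next Lanczos vector, to which
  \<open>K'\<close> is orthogonal.
\<close>

lemma inner_residual_S':
  assumes "y \<in> K'"
  shows "y \<bullet> mr_r S' = s'\<^sup>2 * (y \<bullet> mr_r S)"
  using v'_orth[OF assms] by (simp add: S'_fields inner_diff_right inner_commute)

text \<open>
  Pairing \<open>A d' = c' q + s' v'\<close> with \<open>d'\<close> loses the term of \<open>v'\<close>, so the step length \<open>c' \<phi>\<close> along \<open>d'\<close>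
  turns the correlation with the residual into a curvature, whatever the sign of \<open>c'\<close>.
\<close>

lemma increment_inner_residual:
  "(mr_x S' - mr_x S) \<bullet> mr_r S' = (s' * mr_phi S)\<^sup>2 * (d' \<bullet> (A *v d'))"
proof -
  have "(mr_x S' - mr_x S) \<bullet> mr_r S' = c' * mr_phi S * (d' \<bullet> mr_r S')"
    by (simp add: S'_fields)
  also have "d' \<bullet> mr_r S' = s'\<^sup>2 * mr_phi S * (d' \<bullet> q)"
    by (simp add: inner_residual_S'[OF d'_in] residual_eq_phi_q)
  finally have "(mr_x S' - mr_x S) \<bullet> mr_r S' = (s' * mr_phi S)\<^sup>2 * (c' * (d' \<bullet> q))"
    by (simp add: power2_eq_square)
  moreover have "d' \<bullet> (A *v d') = c' * (d' \<bullet> q)"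
    using v'_orth[OF d'_in] by (simp add: A_d' inner_add_right inner_commute)
  ultimately show ?thesis by simp
qed

lemma step_monotone:
  assumes pos: "\<And>y. y \<in> K' \<Longrightarrow> y \<noteq> 0 \<Longrightarrow> 0 < y \<bullet> (A *v y)"
    and npc: "mr_c S * \<gamma>1 < 0"
    and nonneg: "0 \<le> mr_x S \<bullet> mr_r S"
  shows "mr_x S \<bullet> mr_r S' < mr_x S' \<bullet> mr_r S'"
    and "mr_x S \<bullet> mr_r S' = 0 \<longleftrightarrow> mr_x S \<bullet> mr_r S = 0"
    and "0 \<le> mr_x S \<bullet> mr_r S'"
    and "mr_x S' \<bullet> mr_r S' < mr_x S' \<bullet> mr_r S"
proof -
  have "0 < (s' * mr_phi S)\<^sup>2 * (d' \<bullet> (A *v d'))"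
    using pos[OF d'_in d'_nonzero] s'_pos phi_pos by simp
  then show less: "mr_x S \<bullet> mr_r S' < mr_x S' \<bullet> mr_r S'"
    using increment_inner_residual by (simp add: inner_diff_left)
  have old: "mr_x S \<bullet> mr_r S' = s'\<^sup>2 * (mr_x S \<bullet> mr_r S)"
    by (rule inner_residual_S'[OF K_subset[OF x_in]])
  then show "mr_x S \<bullet> mr_r S' = 0 \<longleftrightarrow> mr_x S \<bullet> mr_r S = 0"
    and ge: "0 \<le> mr_x S \<bullet> mr_r S'"
    using s'_pos nonneg by auto
  have "mr_x S' \<in> K'" using K_subset[OF x_in] d'_in by (auto simp: S'_fields)
  then have new: "mr_x S' \<bullet> mr_r S' = s'\<^sup>2 * (mr_x S' \<bullet> mr_r S)"
    by (rule inner_residual_S')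
  \<comment> \<open>Without detection the sine of the rotation is below one, so the residual strictly shrinks.\<close>
  have "c' \<noteq> 0" using npc \<gamma>2_pos by (auto simp: c'_def)
  then have "s'\<^sup>2 < 1" using rotation' by (smt (verit) zero_less_power2)
  moreover have "0 < mr_x S' \<bullet> mr_r S"
    using less ge new by (smt (verit) mult_nonneg_nonpos zero_le_power2)
  ultimately show "mr_x S' \<bullet> mr_r S' < mr_x S' \<bullet> mr_r S"
    unfolding new by simp
qed

end

end

section \<open>Monotonicity up to the detection of nonpositive curvature\<close>

lemma minres_Suc: "minres A b (Suc k) = minres_step A (minres A b k)"
  by (simp add: minres_def)

lemma minres_init_regular:
  assumes "transpose A = A" and "b \<noteq> 0" and "is_grade A b g"
  shows "minres_regular A b g 0 (minres A b 0)"
proof -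
  have "b \<in> krylov A b (Suc 0)" using power_in_krylov[of 0 "Suc 0" A b] by simp
  then have "(1 / norm b) *\<^sub>R b \<in> krylov A b (Suc 0)"
    by (intro subspace_scale[OF subspace_krylov])
  then show ?thesis
    using assms
    by unfold_locales
      (auto simp: minres_def minres_init_def residual_direction_def krylov_0 is_grade_def)
qed

lemma minres_regular_minres:
  assumes "transpose A = A" and "b \<noteq> 0" and "is_grade A b g" and "k < g"
  shows "minres_regular A b g k (minres A b k)"
  using \<open>k < g\<close>
proof (induction k)
  case 0
  show ?case by (rule minres_init_regular[OF assms(1-3)])
next
  case (Suc k)
  then interpret minres_regular A b g k "minres A b k" by simp
  show ?case using step_regular[OF Suc.prems] by (simp add: minres_Suc S'_def)
qed

lemma minres_positive_definite:
  assumes "transpose A = A" and "b \<noteq> 0" and "is_grade A b g" and "k < g"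
    and "\<forall>i. 1 \<le> i \<and> i \<le> k \<longrightarrow> minres_c A b (i - 1) * minres_gamma1 A b i < 0"
    and "y \<in> krylov A b k" and "y \<noteq> 0"
  shows "0 < y \<bullet> (A *v y)"
  using assms(4-)
proof (induction k arbitrary: y)
  case 0
  then show ?case by (simp add: krylov_0)
next
  case (Suc k)
  interpret minres_regular A b g k "minres A b k"
    using Suc.prems minres_regular_minres[OF assms(1-3)] by simp
  have "minres_gamma1 A b (Suc k) = \<gamma>1"
    using S'_fields(6)[OF Suc.prems(1)] by (simp add: S'_def minres_Suc)
  moreover have "minres_c A b k * minres_gamma1 A b (Suc k) < 0"
    using Suc.prems(2)[rule_format, of "Suc k"] by simp
  ultimately have npc: "minres_c A b k * \<gamma>1 < 0" by simp
  have "0 < z \<bullet> (A *v z)" if "z \<in> K" "z \<noteq> 0" for z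
    using Suc.IH[OF _ _ that] Suc.prems(1,2) by simp
  from positive_definite_extend[OF this npc Suc.prems(3,4)] show ?case .
qed

lemma minres_step_monotone:
  assumes "transpose A = A" and "b \<noteq> 0" and "is_grade A b g" and "Suc k < g"
    and npc: "\<forall>i. 1 \<le> i \<and> i \<le> Suc k \<longrightarrow> minres_c A b (i - 1) * minres_gamma1 A b i < 0"
    and nonneg: "0 \<le> minres_x A b k \<bullet> minres_r A b k"
  shows "minres_x A b k \<bullet> minres_r A b (Suc k) < minres_x A b (Suc k) \<bullet> minres_r A b (Suc k)"
    and "minres_x A b k \<bullet> minres_r A b (Suc k) = 0 \<longleftrightarrow> minres_x A b k \<bullet> minres_r A b k = 0"
    and "0 \<le> minres_x A b k \<bullet> minres_r A b (Suc k)"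
    and "minres_x A b (Suc k) \<bullet> minres_r A b (Suc k) < minres_x A b (Suc k) \<bullet> minres_r A b k"
proof -
  interpret minres_regular A b g k "minres A b k"
    using \<open>Suc k < g\<close> minres_regular_minres[OF assms(1-3)] by simp
  have "minres_gamma1 A b (Suc k) = \<gamma>1"
    using S'_fields(6)[OF \<open>Suc k < g\<close>] by (simp add: S'_def minres_Suc)
  moreover have "minres_c A b k * minres_gamma1 A b (Suc k) < 0"
    using npc[rule_format, of "Suc k"] by simp
  ultimately have curvature: "minres_c A b k * \<gamma>1 < 0" by simp
  have positive: "0 < y \<bullet> (A *v y)" if "y \<in> K'" "y \<noteq> 0" for y
    using minres_positive_definite[OF assms(1-5) that] .
  note mono = step_monotone[OF \<open>Suc k < g\<close> positive curvature nonneg,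
      unfolded S'_def minres_Suc[symmetric]]
  show "minres_x A b k \<bullet> minres_r A b (Suc k) < minres_x A b (Suc k) \<bullet> minres_r A b (Suc k)"
    and "minres_x A b k \<bullet> minres_r A b (Suc k) = 0 \<longleftrightarrow> minres_x A b k \<bullet> minres_r A b k = 0"
    and "0 \<le> minres_x A b k \<bullet> minres_r A b (Suc k)"
    and "minres_x A b (Suc k) \<bullet> minres_r A b (Suc k) < minres_x A b (Suc k) \<bullet> minres_r A b k"
    using mono by simp_all
qed

lemma minres_inner_residual_pos:
  assumes "transpose A = A" and "b \<noteq> 0" and "is_grade A b g" and "k < g"
    and "\<forall>i. 1 \<le> i \<and> i \<le> k \<longrightarrow> minres_c A b (i - 1) * minres_gamma1 A b i < 0"
  shows "if k = 0 then minres_x A b k \<bullet> minres_r A b k = 0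
    else 0 < minres_x A b k \<bullet> minres_r A b k"
  using assms(4-)
proof (induction k)
  case 0
  show ?case by (simp add: minres_def minres_init_def)
next
  case (Suc k)
  then have "0 \<le> minres_x A b k \<bullet> minres_r A b k" by (auto split: if_splits)
  from minres_step_monotone[OF assms(1-3) Suc.prems this] show ?case by simp
qed

theorem theorem4:
  fixes A :: "real^'n^'n" and b :: "real^'n" and g k :: nat
  assumes "transpose A = A"
    and "b \<noteq> 0"
    and "is_grade A b g"
    and "1 \<le> k" and "k < g"
    and "\<forall>i. 1 \<le> i \<and> i \<le> k \<longrightarrow> minres_c A b (i - 1) * minres_gamma1 A b i < 0"
  shows "minres_x A b k \<bullet> b - minres_x A b k \<bullet> (A *v minres_x A b k) > 0
    \<and> minres_x A b k \<bullet> minres_r A b k > minres_x A b (k - 1) \<bullet> minres_r A b k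
    \<and> minres_x A b (k - 1) \<bullet> minres_r A b k \<ge> 0
    \<and> minres_x A b k \<bullet> minres_r A b (k - 1) > minres_x A b k \<bullet> minres_r A b k
    \<and> minres_x A b k \<bullet> minres_r A b k > 0
    \<and> (minres_x A b (k - 1) \<bullet> minres_r A b k = 0 \<longleftrightarrow> k = 1)"
proof -
  obtain j where j: "k = Suc j" using \<open>1 \<le> k\<close> by (cases k) auto
  have old: "if j = 0 then minres_x A b j \<bullet> minres_r A b j = 0
      else 0 < minres_x A b j \<bullet> minres_r A b j"
    using assms j by (intro minres_inner_residual_pos[OF assms(1-3)]) auto
  then have "0 \<le> minres_x A b j \<bullet> minres_r A b j" by (auto split: if_splits)
  note step = minres_step_monotone[OF assms(1-3,5,6)[unfolded j] this, folded j]
  have new: "0 < minres_x A b k \<bullet> minres_r A b k"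
    using minres_inner_residual_pos[OF assms(1-3,5,6)] \<open>1 \<le> k\<close> by simp
  interpret minres_regular A b g k "minres A b k"
    by (rule minres_regular_minres[OF assms(1-3,5)])
  have "minres_x A b k \<bullet> minres_r A b k
      = minres_x A b k \<bullet> b - minres_x A b k \<bullet> (A *v minres_x A b k)"
    by (simp add: residual inner_diff_right)
  moreover have "minres_x A b j \<bullet> minres_r A b j = 0 \<longleftrightarrow> k = 1"
    using old j by (auto split: if_splits)
  ultimately show ?thesis using step new j by simp
qed

end
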